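(* Let $k\ge 1$. For all primes $p$ and all integers $r\ge 2$, $$\Delta_k(p^r)=\sum_{n_1+n_2+\cdots+n_k=p^{r-1}}\binom{p^{r-1}}{n_1\ n_2\ \cdots\ n_k}\left(\binom{p^{r-1}}{n_1\ n_2\ \cdots\ n_k}^{p-1}-1\right),$$ where the sum is over all $k$-tuples $(n_1,\dots,n_k)$ of nonnegative integers with sum $p^{r-1}$ and $\binom{N}{n_1\ \cdots\ n_k}=\frac{N!}{n_1!\cdots n_k!}$ is the multinomial coefficient.
   Context: A word $w$ over an alphabet $\Sigma$ is primitive if it cannot be written as $z^j$ with $z\in\Sigma^*$ and $j\ge2$. The Parikh vector $\Psi(w)$ of $w$ is the vector of numbers of occurrences in $w$ of each letter of $\Sigma$. A word $w$ is a $j$-th Abelian power if $w=u_1u_2\cdots u_j$ with $\Psi(u_i)=\Psi(u_{i'})$ for all $1\le i,i'\le j$; it is A-primitive if it is not a $j$-th Abelian power for any $j\ge2$. Let $\psi_k(n)$ be the number of primitive words of length $n$ over a $k$-letter alphabet, $\psi_k^A(n)$ the number of A-primitive words of length $n$ over a $k$-letter alphabet, and $\Delta_k(n)=\psi_k(n)-\psi_k^A(n)$. *)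

theory Defs
  imports "HOL-Computational_Algebra.Primes" "HOL-Library.FuncSet"
begin

text \<open>A \<open>k\<close>-letter alphabet is any set \<open>\<Sigma>\<close> with \<open>card \<Sigma> = k\<close>; words over it are the elements
  of \<open>lists \<Sigma>\<close>.\<close>

definition word_power :: "'a list \<Rightarrow> nat \<Rightarrow> 'a list" where
  "word_power z j = concat (replicate j z)"

definition primitive_word :: "'a set \<Rightarrow> 'a list \<Rightarrow> bool" where
  "primitive_word \<Sigma> w \<longleftrightarrow> \<not> (\<exists>z \<in> lists \<Sigma>. \<exists>j\<ge>2. w = word_power z j)"

text \<open>Vectors indexed by \<open>\<Sigma>\<close> are functions restricted to \<open>\<Sigma>\<close>, so that equality of vectors is
  equality of functions.\<close>

definition parikh :: "'a set \<Rightarrow> 'a list \<Rightarrow> 'a \<Rightarrow> nat" where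
  "parikh \<Sigma> w = (\<lambda>a\<in>\<Sigma>. count_list w a)"

definition abelian_power :: "'a set \<Rightarrow> nat \<Rightarrow> 'a list \<Rightarrow> bool" where
  "abelian_power \<Sigma> j w \<longleftrightarrow>
     (\<exists>us. length us = j \<and> us \<in> lists (lists \<Sigma>) \<and> w = concat us \<and>
           (\<forall>i<j. \<forall>i'<j. parikh \<Sigma> (us ! i) = parikh \<Sigma> (us ! i')))"

definition A_primitive_word :: "'a set \<Rightarrow> 'a list \<Rightarrow> bool" where
  "A_primitive_word \<Sigma> w \<longleftrightarrow> \<not> (\<exists>j\<ge>2. abelian_power \<Sigma> j w)"

definition psi :: "'a set \<Rightarrow> nat \<Rightarrow> nat" where
  "psi \<Sigma> n = card {w \<in> lists \<Sigma>. length w = n \<and> primitive_word \<Sigma> w}"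

definition psi_A :: "'a set \<Rightarrow> nat \<Rightarrow> nat" where
  "psi_A \<Sigma> n = card {w \<in> lists \<Sigma>. length w = n \<and> A_primitive_word \<Sigma> w}"

definition Delta :: "'a set \<Rightarrow> nat \<Rightarrow> int" where
  "Delta \<Sigma> n = int (psi \<Sigma> n) - int (psi_A \<Sigma> n)"

definition compositions :: "nat \<Rightarrow> nat \<Rightarrow> nat list set" where
  "compositions k N = {ns. length ns = k \<and> sum_list ns = N}"

definition multinomial :: "nat \<Rightarrow> nat list \<Rightarrow> nat" where
  "multinomial N ns = fact N div prod_list (map fact ns)"

text \<open>The division in \<open>multinomial\<close> is exact whenever the parts sum to \<open>N\<close>.\<close>

lemma prod_list_fact_dvd_fact:
  "prod_list (map fact ns) dvd (fact (sum_list ns) :: nat)"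
proof (induction ns)
  case (Cons n ns)
  have "fact n * prod_list (map fact ns) dvd fact n * (fact (sum_list ns) :: nat)"
    using Cons.IH by (rule mult_dvd_mono[OF dvd_refl])
  also have "\<dots> dvd fact (n + sum_list ns)"
    by (rule fact_fact_dvd_fact)
  finally show ?case by simp
qed simp

end

theory Submission
  imports Defs "HOL-Combinatorics.Multiset_Permutations"
begin

text \<open>If a word of length \<open>p ^ r\<close> with \<open>r > 0\<close> is an (Abelian) \<open>j\<close>-th power with \<open>j \<ge> 2\<close>, then
  \<open>p\<close> divides \<open>j\<close>, so grouping consecutive blocks makes it an (Abelian) \<open>p\<close>-th power. Its
  \<open>p\<close> blocks have length \<open>N = p ^ (r - 1)\<close> and determine the word; they may be any equal words, or
  any words with a common content multiset \<open>A\<close>. There are \<open>m A\<close> words with content \<open>A\<close>, where \<open>m A\<close>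
  is a multinomial coefficient, so the two counts are \<open>\<Sum>A. m A\<close> and \<open>\<Sum>A. m A ^ p\<close>.\<close>

section \<open>Powers of words\<close>

lemma word_power_mult: "word_power z (m * n) = word_power (word_power z m) n"
  by (induction n) (simp_all add: word_power_def replicate_add)

lemma length_word_power [simp]: "length (word_power z j) = j * length z"
  by (simp add: word_power_def length_concat sum_list_replicate)

lemma word_power_in_lists: "z \<in> lists \<Sigma> \<Longrightarrow> word_power z j \<in> lists \<Sigma>"
  by (auto simp: word_power_def)

text \<open>A positive power begins with its base, so once the length of the base is known the base
  is recovered as a prefix.\<close>

lemma inj_on_word_power:
  assumes "j > 0"
  shows "inj_on (\<lambda>z. word_power z j) {z. length z = n}"
proof (rule inj_onI)
  fix x y :: "'a list"
  assume "x \<in> {z. length z = n}" "y \<in> {z. length z = n}" and eq: "word_power x j = word_power y j"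
  moreover obtain i where "j = Suc i" using assms gr0_implies_Suc by blast
  ultimately show "x = y" by (simp add: word_power_def)
qed

section \<open>Abelian powers in terms of content multisets\<close>

text \<open>Letters outside \<open>\<Sigma>\<close> occur in neither word, so restricting the counts
  to \<open>\<Sigma>\<close> loses nothing and library facts on multisets become available.\<close>

lemma parikh_eq_iff_mset_eq:
  assumes "u \<in> lists \<Sigma>" "v \<in> lists \<Sigma>"
  shows "parikh \<Sigma> u = parikh \<Sigma> v \<longleftrightarrow> mset u = mset v"
proof
  assume eq: "parikh \<Sigma> u = parikh \<Sigma> v"
  show "mset u = mset v"
  proof (rule multiset_eqI)
    fix a
    show "count (mset u) a = count (mset v) a"
    proof (cases "a \<in> \<Sigma>")
      case True
      then show ?thesis using fun_cong[OF eq, of a] by (simp add: parikh_def count_mset)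
    next
      case False
      then have "a \<notin> set u" "a \<notin> set v" using assms by auto
      then show ?thesis by (simp add: count_mset)
    qed
  qed
next
  assume "mset u = mset v"
  then have "count_list u a = count_list v a" for a by (metis count_mset)
  then show "parikh \<Sigma> u = parikh \<Sigma> v" by (simp add: parikh_def)
qed

text \<open>The content of the first block serves as \<open>A\<close>. Naming the common content
  replaces pairwise comparison of blocks and gives the index by which Abelian powers are later
  counted.\<close>

lemma abelian_power_iff_mset:
  assumes "j > 0"
  shows "abelian_power \<Sigma> j w \<longleftrightarrow>
    (\<exists>us A. length us = j \<and> us \<in> lists (lists \<Sigma>) \<and> w = concat us \<and> (\<forall>u\<in>set us. mset u = A))"
    (is "_ \<longleftrightarrow> ?R")
proof
  assume "abelian_power \<Sigma> j w"
  then obtain us where us: "length us = j" "us \<in> lists (lists \<Sigma>)" "w = concat us"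
    and eq: "\<forall>i<j. \<forall>i'<j. parikh \<Sigma> (us ! i) = parikh \<Sigma> (us ! i')"
    by (auto simp: abelian_power_def)
  have "us ! i \<in> lists \<Sigma>" if "i < j" for i
    using us that by (metis in_listsD nth_mem)
  then have "mset (us ! i) = mset (us ! 0)" if "i < j" for i
    using eq assms that parikh_eq_iff_mset_eq by metis
  then have "\<forall>u\<in>set us. mset u = mset (us ! 0)"
    using us(1) by (metis in_set_conv_nth)
  then show ?R using us by blast
next
  assume ?R
  then obtain us A where us: "length us = j" "us \<in> lists (lists \<Sigma>)" "w = concat us"
    and eq: "\<forall>u\<in>set us. mset u = A" by blast
  have "parikh \<Sigma> (us ! i) = parikh \<Sigma> (us ! i')" if "i < j" "i' < j" for i i'
  proof -
    have "us ! i \<in> set us" "us ! i' \<in> set us" using that us(1) by auto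
    with us(2) eq show ?thesis by (metis in_listsD parikh_eq_iff_mset_eq)
  qed
  with us show "abelian_power \<Sigma> j w" by (auto simp: abelian_power_def)
qed

lemma mset_concat_const:
  "\<forall>u\<in>set us. mset u = A \<Longrightarrow> mset (concat us) = repeat_mset (length us) A"
  by (induction us) auto

lemma length_concat_const:
  "\<forall>u\<in>set us. mset u = A \<Longrightarrow> length (concat us) = length us * size A"
  by (induction us) auto

text \<open>Gluing each run of \<open>m\<close> consecutive blocks into one leaves \<open>n\<close>
  blocks, whose contents agree because each is the sum of \<open>m\<close> copies of
  \<open>A\<close>.\<close>

lemma abelian_power_mult:
  assumes "abelian_power \<Sigma> (m * n) w" "m > 0" "n > 0"
  shows "abelian_power \<Sigma> n w"
proof -
  \<comment> \<open>The explicit content \<open>repeat_mset m A\<close> makes the induction work: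
    the blocks from the induction hypothesis then match the new block formed from the first
    \<open>m\<close> words.\<close>
  have "\<exists>vs. length vs = n \<and> vs \<in> lists (lists \<Sigma>) \<and> concat us = concat vs \<and>
      (\<forall>v\<in>set vs. mset v = repeat_mset m A)"
    if "length us = m * n" "us \<in> lists (lists \<Sigma>)" "\<forall>u\<in>set us. mset u = A" for us A
    using that
  proof (induction n arbitrary: us)
    case 0
    then show ?case by simp
  next
    case (Suc n)
    have "\<exists>vs. length vs = n \<and> vs \<in> lists (lists \<Sigma>) \<and> concat (drop m us) = concat vs \<and>
        (\<forall>v\<in>set vs. mset v = repeat_mset m A)"
      using Suc.prems by (intro Suc.IH) (auto dest: in_set_dropD)
    then obtain vs where vs: "length vs = n" "vs \<in> lists (lists \<Sigma>)"
      "concat (drop m us) = concat vs" "\<forall>v\<in>set vs. mset v = repeat_mset m A" by blast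
    have "mset (concat (take m us)) = repeat_mset (length (take m us)) A"
      using Suc.prems by (intro mset_concat_const) (auto dest: in_set_takeD)
    then have "mset (concat (take m us)) = repeat_mset m A"
      using Suc.prems by simp
    moreover have "concat (take m us) \<in> lists \<Sigma>"
      using Suc.prems by (fastforce dest: in_set_takeD)
    moreover have "concat us = concat (take m us) @ concat (drop m us)"
      by (metis append_take_drop_id concat_append)
    ultimately show ?case
      using vs by (intro exI[of _ "concat (take m us) # vs"]) auto
  qed
  then show ?thesis
    using assms by (simp add: abelian_power_iff_mset) blast
qed

lemma abelian_power_dvd_length:
  assumes "abelian_power \<Sigma> j w" "j > 0"
  shows "j dvd length w"
proof -
  obtain us A where us: "length us = j" "w = concat us" "\<forall>u\<in>set us. mset u = A"
    using assms by (auto simp: abelian_power_iff_mset)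
  then show ?thesis using length_concat_const[OF us(3)] by simp
qed

section \<open>Reduction to exponent \<open>p\<close> for words of prime power length\<close>

lemma prime_dvd_of_dvd_prime_power:
  fixes p j :: nat
  assumes "prime p" "j dvd p ^ r" "j \<ge> 2"
  shows "p dvd j"
proof -
  \<comment> \<open>Exponent \<open>i = 0\<close> would give \<open>j = 1\<close>, against
    \<open>j \<ge> 2\<close>.\<close>
  obtain i where "j = p ^ i" using assms divides_primepow_nat by blast
  then show ?thesis using assms(3) by (cases i) auto
qed

text \<open>The exponent \<open>j\<close> divides the length \<open>p ^ r\<close>, so
  \<open>j = m * p\<close>, and the \<open>m\<close>-th power of the old base is a base for exponent
  \<open>p\<close>.\<close>

lemma not_primitive_word_iff:
  assumes "prime p" "length w = p ^ r"
  shows "\<not> primitive_word \<Sigma> w \<longleftrightarrow> (\<exists>z\<in>lists \<Sigma>. w = word_power z p)"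
proof
  assume "\<not> primitive_word \<Sigma> w"
  then obtain z j where z: "z \<in> lists \<Sigma>" "j \<ge> 2" "w = word_power z j"
    by (auto simp: primitive_word_def)
  have "p dvd j"
    using prime_dvd_of_dvd_prime_power[OF assms(1) _ z(2), of r] assms(2) z(3)
    by (metis dvd_triv_left length_word_power)
  then obtain m where "j = m * p" by (metis dvd_def mult.commute)
  with z show "\<exists>z\<in>lists \<Sigma>. w = word_power z p"
    by (metis word_power_mult word_power_in_lists)
next
  assume "\<exists>z\<in>lists \<Sigma>. w = word_power z p"
  then show "\<not> primitive_word \<Sigma> w"
    using prime_ge_2_nat[OF assms(1)] by (auto simp: primitive_word_def)
qed

lemma not_A_primitive_word_iff:
  assumes "prime p" "length w = p ^ r"
  shows "\<not> A_primitive_word \<Sigma> w \<longleftrightarrow> abelian_power \<Sigma> p w"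
proof
  assume "\<not> A_primitive_word \<Sigma> w"
  then obtain j where j: "j \<ge> 2" "abelian_power \<Sigma> j w"
    by (auto simp: A_primitive_word_def)
  have "p dvd j"
    using prime_dvd_of_dvd_prime_power[OF assms(1)] assms(2) j abelian_power_dvd_length[OF j(2)]
    by auto
  then obtain m where m: "j = m * p" by (metis dvd_def mult.commute)
  with j have "m > 0" by (cases m) auto
  with j m show "abelian_power \<Sigma> p w"
    using prime_gt_0_nat[OF assms(1)] abelian_power_mult by blast
next
  assume "abelian_power \<Sigma> p w"
  then show "\<not> A_primitive_word \<Sigma> w"
    using prime_ge_2_nat[OF assms(1)] by (auto simp: A_primitive_word_def)
qed

section \<open>Counting powers and Abelian powers by content\<close>

text \<open>These are the possible contents of words of length \<open>N\<close>, a form of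
  \<open>compositions\<close> that needs no ordering of the alphabet.\<close>

definition multisets_of :: "'a set \<Rightarrow> nat \<Rightarrow> 'a multiset set" where
  "multisets_of \<Sigma> N = {A. set_mset A \<subseteq> \<Sigma> \<and> size A = N}"

lemma finite_multisets_of:
  assumes "finite \<Sigma>"
  shows "finite (multisets_of \<Sigma> N)"
proof -
  have "A \<in> mset ` {w. set w \<subseteq> \<Sigma> \<and> length w = N}" if "A \<in> multisets_of \<Sigma> N" for A
    using that ex_mset[of A] by (force simp: multisets_of_def)
  then have "multisets_of \<Sigma> N \<subseteq> mset ` {w. set w \<subseteq> \<Sigma> \<and> length w = N}" by blast
  then show ?thesis
    by (rule finite_subset) (intro finite_imageI finite_lists_length_eq assms)
qed

lemma words_eq_Union_permutations:
  "{w \<in> lists \<Sigma>. length w = N} = (\<Union>A\<in>multisets_of \<Sigma> N. permutations_of_multiset A)"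
  by (auto simp: multisets_of_def permutations_of_multiset_def)

lemma card_words:
  assumes "finite \<Sigma>"
  shows "card {w \<in> lists \<Sigma>. length w = N} =
    (\<Sum>A\<in>multisets_of \<Sigma> N. card (permutations_of_multiset A))"
  unfolding words_eq_Union_permutations
  by (rule card_UN_disjoint)
     (auto simp: finite_multisets_of assms dest: permutations_of_multisetD)

text \<open>Powers correspond to their bases of length \<open>N\<close>. Sorting the bases by
  content yields the same index set as in the count of Abelian powers, so the two sums can be
  subtracted termwise.\<close>

lemma card_powers:
  assumes "finite \<Sigma>" "j > 0"
  shows "card {w \<in> lists \<Sigma>. length w = j * N \<and> (\<exists>z\<in>lists \<Sigma>. w = word_power z j)} =
    (\<Sum>A\<in>multisets_of \<Sigma> N. card (permutations_of_multiset A))"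
proof -
  have "{w \<in> lists \<Sigma>. length w = j * N \<and> (\<exists>z\<in>lists \<Sigma>. w = word_power z j)} =
      (\<lambda>z. word_power z j) ` {w \<in> lists \<Sigma>. length w = N}"
    using assms(2) word_power_in_lists[of _ \<Sigma> j] by auto
  moreover have "inj_on (\<lambda>z. word_power z j) {w \<in> lists \<Sigma>. length w = N}"
    by (rule inj_on_subset[OF inj_on_word_power[OF assms(2), of N]]) auto
  ultimately show ?thesis
    by (simp add: card_image card_words[OF assms(1)])
qed

text \<open>An Abelian power amounts to a content \<open>A\<close> and \<open>j\<close> independent
  arrangements of \<open>A\<close>. This description is unique, since the blocks all have length
  \<open>N\<close> and any block determines \<open>A\<close>.\<close>

lemma card_abelian_powers:
  assumes "finite \<Sigma>" "j > 0"
  shows "card {w \<in> lists \<Sigma>. length w = j * N \<and> abelian_power \<Sigma> j w} =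
    (\<Sum>A\<in>multisets_of \<Sigma> N. card (permutations_of_multiset A) ^ j)"
proof -
  define B where "B A = {us. set us \<subseteq> permutations_of_multiset A \<and> length us = j}"
    for A :: "'a multiset"
  have len: "length u = N" if "us \<in> B A" "A \<in> multisets_of \<Sigma> N" "u \<in> set us" for us A u
    using that by (auto simp: B_def multisets_of_def permutations_of_multiset_def)
  have "{w \<in> lists \<Sigma>. length w = j * N \<and> abelian_power \<Sigma> j w} =
      concat ` (\<Union>A\<in>multisets_of \<Sigma> N. B A)" (is "?L = ?R")
  proof
    show "?L \<subseteq> ?R"
    proof
      fix w assume w: "w \<in> ?L"
      then obtain us A where us: "length us = j" "us \<in> lists (lists \<Sigma>)" "w = concat us"
        "\<forall>u\<in>set us. mset u = A"
        using assms(2) by (auto simp: abelian_power_iff_mset)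
      have "length w = j * size A"
        using us length_concat_const[OF us(4)] by simp
      then have "size A = N" using w assms(2) by simp
      moreover have "set_mset A \<subseteq> \<Sigma>"
      proof -
        have "us ! 0 \<in> set us" using us(1) assms(2) by simp
        then have "A = mset (us ! 0)" "us ! 0 \<in> lists \<Sigma>" using us by auto
        then show ?thesis by auto
      qed
      ultimately have "A \<in> multisets_of \<Sigma> N" by (simp add: multisets_of_def)
      moreover have "us \<in> B A" using us by (auto simp: B_def permutations_of_multiset_def)
      ultimately show "w \<in> ?R" using us(3) by blast
    qed
    show "?R \<subseteq> ?L"
    proof
      fix w assume "w \<in> ?R"
      then obtain us A where A: "A \<in> multisets_of \<Sigma> N" and us: "us \<in> B A" and w: "w = concat us"
        by blast
      have eq: "\<forall>u\<in>set us. mset u = A" and l: "length us = j"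
        using us by (auto simp: B_def permutations_of_multiset_def)
      have "set u \<subseteq> \<Sigma>" if "u \<in> set us" for u
        using eq that A by (auto simp: multisets_of_def simp flip: set_mset_mset)
      then have us': "us \<in> lists (lists \<Sigma>)" by auto
      have "length w = j * N"
        using A l w length_concat_const[OF eq] by (simp add: multisets_of_def)
      moreover have "w \<in> lists \<Sigma>" using us' w by fastforce
      moreover have "abelian_power \<Sigma> j w"
        using assms(2) us' eq l w by (auto simp: abelian_power_iff_mset)
      ultimately show "w \<in> ?L" by simp
    qed
  qed
  moreover have "inj_on concat (\<Union>A\<in>multisets_of \<Sigma> N. B A)"
  proof (rule inj_onI)
    fix us vs
    assume us: "us \<in> (\<Union>A\<in>multisets_of \<Sigma> N. B A)" and vs: "vs \<in> (\<Union>A\<in>multisets_of \<Sigma> N. B A)"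
      and eq: "concat us = concat vs"
    \<comment> \<open>\<open>concat\<close> is injective only on lists whose corresponding blocks
      have equal lengths; here every block has length \<open>N\<close>, even if the two contents
      differ.\<close>
    have "\<forall>(x, y)\<in>set (zip us vs). length x = length y"
    proof clarify
      fix x y assume "(x, y) \<in> set (zip us vs)"
      then have "x \<in> set us" "y \<in> set vs" by (auto dest: set_zip_leftD set_zip_rightD)
      then show "length x = length y" using us vs len by (metis UN_E)
    qed
    moreover have "length us = length vs" using us vs by (auto simp: B_def)
    ultimately show "us = vs" using eq concat_injective by blast
  qed
  moreover have "card (\<Union>A\<in>multisets_of \<Sigma> N. B A) = (\<Sum>A\<in>multisets_of \<Sigma> N. card (B A))"
  proof (rule card_UN_disjoint)
    show "finite (multisets_of \<Sigma> N)" by (rule finite_multisets_of) fact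
    show "\<forall>A\<in>multisets_of \<Sigma> N. finite (B A)"
      by (auto simp: B_def intro!: finite_lists_length_eq)
    have "A = A'" if "us \<in> B A" "us \<in> B A'" for us A A'
    proof -
      \<comment> \<open>As \<open>j > 0\<close>, there is a first block, and its content is both
        \<open>A\<close> and \<open>A'\<close>.\<close>
      have "us ! 0 \<in> set us" using that assms(2) by (simp add: B_def)
      then show ?thesis using that by (auto simp: B_def permutations_of_multiset_def)
    qed
    then show "\<forall>A\<in>multisets_of \<Sigma> N. \<forall>A'\<in>multisets_of \<Sigma> N. A \<noteq> A' \<longrightarrow> B A \<inter> B A' = {}"
      by blast
  qed
  ultimately show ?thesis
    by (simp add: card_image B_def card_lists_length_eq)
qed

section \<open>Contents as compositions, and multinomial coefficients\<close>

text \<open>The list \<open>xs\<close> orders the alphabet, and a composition records the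
  multiplicities of a content in that order.\<close>

lemma bij_betw_multisets_compositions:
  assumes "distinct xs"
  shows "bij_betw (\<lambda>A. map (count A) xs) (multisets_of (set xs) N) (compositions (length xs) N)"
proof (rule bij_betwI')
  fix A B :: "'a multiset"
  assume A: "A \<in> multisets_of (set xs) N" and B: "B \<in> multisets_of (set xs) N"
  show "map (count A) xs = map (count B) xs \<longleftrightarrow> A = B"
  proof
    assume eq: "map (count A) xs = map (count B) xs"
    show "A = B"
    proof (rule multiset_eqI)
      fix a
      show "count A a = count B a"
      proof (cases "a \<in> set xs")
        case True
        then show ?thesis using eq by auto
      next
        case False
        then have "a \<notin># A" "a \<notin># B" using A B by (auto simp: multisets_of_def)
        then show ?thesis by (simp add: not_in_iff)
      qed
    qed
  qed simp
next
  fix A :: "'a multiset"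
  assume A: "A \<in> multisets_of (set xs) N"
  have "(\<Sum>x\<in>set_mset A. count A x) = (\<Sum>x\<in>set xs. count A x)"
    using A by (intro sum.mono_neutral_left) (auto simp: multisets_of_def not_in_iff)
  then show "map (count A) xs \<in> compositions (length xs) N"
    using A assms
    by (simp add: compositions_def multisets_of_def sum_list_distinct_conv_sum_set size_multiset_overloaded_eq)
next
  fix ns assume "ns \<in> compositions (length xs) N"
  then have l: "length xs = length ns" and s: "sum_list ns = N" by (auto simp: compositions_def)
  \<comment> \<open>Surjectivity is stated with \<open>sum_list ns\<close> instead of the fixed
    \<open>N\<close>, because the total changes as the lists grow in the induction.\<close>
  have "\<exists>A. set_mset A \<subseteq> set xs \<and> size A = sum_list ns \<and> ns = map (count A) xs"
    using l assms
  proof (induction xs ns rule: list_induct2)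
    case Nil
    then show ?case by simp
  next
    case (Cons x xs n ns)
    then obtain A where A: "set_mset A \<subseteq> set xs" "size A = sum_list ns" "ns = map (count A) xs"
      by auto
    \<comment> \<open>Distinctness puts \<open>x\<close> outside \<open>xs\<close>, so adding
      \<open>n\<close> copies of \<open>x\<close> gives it multiplicity exactly \<open>n\<close> and
      leaves the other counts alone.\<close>
    then have "count A x = 0" using Cons.prems by (auto simp: not_in_iff[symmetric])
    moreover have "map (count (replicate_mset n x + A)) xs = map (count A) xs"
      using Cons.prems by auto
    ultimately show ?case
      using A by (intro exI[of _ "replicate_mset n x + A"]) (auto split: if_splits)
  qed
  then show "\<exists>A\<in>multisets_of (set xs) N. ns = map (count A) xs"
    using s by (auto simp: multisets_of_def)
qed

lemma multinomial_count_eq_card: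
  assumes "distinct xs" "A \<in> multisets_of (set xs) N"
  shows "multinomial N (map (count A) xs) = card (permutations_of_multiset A)"
proof -
  \<comment> \<open>The library formula for the number of permutations multiplies only over letters
    that occur; absent ones contribute \<open>fact 0 = 1\<close>.\<close>
  have "(\<Prod>x\<in>set_mset A. fact (count A x) :: nat) = (\<Prod>x\<in>set xs. fact (count A x))"
    using assms by (intro prod.mono_neutral_left) (auto simp: multisets_of_def not_in_iff)
  also have "\<dots> = prod_list (map fact (map (count A) xs))"
    using assms(1) by (simp add: prod.distinct_set_conv_list comp_def)
  finally show ?thesis
    using assms(2) by (simp add: multinomial_def card_permutations_of_multiset multisets_of_def)
qed

text \<open>A general \<open>f\<close> allows the entire summand of the theorem to be transferred at
  once.\<close>

lemma sum_compositions:
  assumes "finite \<Sigma>"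
  shows "(\<Sum>ns\<in>compositions (card \<Sigma>) N. f (multinomial N ns)) =
    (\<Sum>A\<in>multisets_of \<Sigma> N. f (card (permutations_of_multiset A)))"
proof -
  obtain xs where xs: "set xs = \<Sigma>" "distinct xs"
    using finite_distinct_list[OF assms] by blast
  then have "card \<Sigma> = length xs" by (metis distinct_card)
  then have "(\<Sum>ns\<in>compositions (card \<Sigma>) N. f (multinomial N ns)) =
      (\<Sum>A\<in>multisets_of \<Sigma> N. f (multinomial N (map (count A) xs)))"
    using sum.reindex_bij_betw[OF bij_betw_multisets_compositions[OF xs(2), of N],
        of "\<lambda>ns. f (multinomial N ns)"] xs(1) by simp
  also have "\<dots> = (\<Sum>A\<in>multisets_of \<Sigma> N. f (card (permutations_of_multiset A)))"
    using multinomial_count_eq_card[OF xs(2)] xs(1) by (intro sum.cong) auto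
  finally show ?thesis .
qed

section \<open>The formula for \<open>Delta\<close>\<close>

text \<open>Both classes are complemented in the same finite set of words, so its cardinality
  cancels and the order of the difference is reversed.\<close>

lemma Delta_eq_diff_complements:
  assumes "finite \<Sigma>"
  shows "Delta \<Sigma> n = int (card {w \<in> lists \<Sigma>. length w = n \<and> \<not> A_primitive_word \<Sigma> w}) -
    int (card {w \<in> lists \<Sigma>. length w = n \<and> \<not> primitive_word \<Sigma> w})"
proof -
  let ?W = "{w \<in> lists \<Sigma>. length w = n}"
  have fin: "finite ?W"
    using finite_lists_length_eq[OF assms, of n] by (simp add: lists_eq_set)
  have split: "card ?W = card {w \<in> lists \<Sigma>. length w = n \<and> P w} +
      card {w \<in> lists \<Sigma>. length w = n \<and> \<not> P w}" for P
  proof -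
    have "?W = {w \<in> lists \<Sigma>. length w = n \<and> P w} \<union> {w \<in> lists \<Sigma>. length w = n \<and> \<not> P w}"
      by auto
    moreover have "finite {w \<in> lists \<Sigma>. length w = n \<and> P w}"
      "finite {w \<in> lists \<Sigma>. length w = n \<and> \<not> P w}"
      by (rule finite_subset[OF _ fin]; blast)+
    moreover have "{w \<in> lists \<Sigma>. length w = n \<and> P w} \<inter> {w \<in> lists \<Sigma>. length w = n \<and> \<not> P w} = {}"
      by blast
    ultimately show ?thesis by (simp only: card_Un_disjoint)
  qed
  show ?thesis
    using split[of "primitive_word \<Sigma>"] split[of "A_primitive_word \<Sigma>"]
    by (simp add: Delta_def psi_def psi_A_def)
qed

theorem lemma4:
  fixes \<Sigma> :: "'a set" and k p r :: nat
  assumes "k \<ge> 1" and "finite \<Sigma>" and "card \<Sigma> = k"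
    and "prime p" and "r \<ge> 2"
  shows "Delta \<Sigma> (p ^ r) =
    (\<Sum>ns\<in>compositions k (p ^ (r - 1)).
       int (multinomial (p ^ (r - 1)) ns) *
         (int (multinomial (p ^ (r - 1)) ns) ^ (p - 1) - 1))"
proof -
  define N where "N = p ^ (r - 1)"
  let ?c = "\<lambda>A :: 'a multiset. int (card (permutations_of_multiset A))"
  have p: "p > 0" using assms(4) by (rule prime_gt_0_nat)
  have pr: "p ^ r = p * N"
    using assms(5) by (simp add: N_def flip: power_Suc)
  have "{w \<in> lists \<Sigma>. length w = p ^ r \<and> \<not> primitive_word \<Sigma> w} =
      {w \<in> lists \<Sigma>. length w = p * N \<and> (\<exists>z\<in>lists \<Sigma>. w = word_power z p)}"
    using not_primitive_word_iff[OF assms(4), of _ r \<Sigma>] by (auto simp: pr)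
  moreover have "{w \<in> lists \<Sigma>. length w = p ^ r \<and> \<not> A_primitive_word \<Sigma> w} =
      {w \<in> lists \<Sigma>. length w = p * N \<and> abelian_power \<Sigma> p w}"
    using not_A_primitive_word_iff[OF assms(4), of _ r \<Sigma>] by (auto simp: pr)
  ultimately have "Delta \<Sigma> (p ^ r) = (\<Sum>A\<in>multisets_of \<Sigma> N. ?c A ^ p - ?c A)"
    by (simp add: Delta_eq_diff_complements assms(2) card_powers card_abelian_powers p sum_subtractf)
  \<comment> \<open>Since \<open>p > 0\<close>, one factor \<open>?c A\<close> can be split off
    \<open>?c A ^ p\<close>.\<close>
  also have "\<dots> = (\<Sum>A\<in>multisets_of \<Sigma> N. ?c A * (?c A ^ (p - 1) - 1))"
    using p by (simp add: right_diff_distrib flip: power_Suc)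
  also have "\<dots> = (\<Sum>ns\<in>compositions k N. int (multinomial N ns) * (int (multinomial N ns) ^ (p - 1) - 1))"
    using sum_compositions[OF assms(2), of "\<lambda>m. int m * (int m ^ (p - 1) - 1)" N] assms(3) by simp
  finally show ?thesis by (simp add: N_def)
qed

end
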